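(* Let $\lambda$ be a partition and $k=|\lambda|$. For each oscillating tableau $T=(\lambda^0,\ldots,\lambda^l)$ let $\mathrm{wt}_{2,0}(T):=\sum_{i=0}^{l}|\lambda^i|^2$. Then for any $n\in\mathbb{N}$, $$\frac{1}{\#\mathcal{OT}(\lambda,k+2n)}\sum_{T\in\mathcal{OT}(\lambda,k+2n)}\mathrm{wt}_{2,0}(T)=(k+2n+1)\cdot\frac{10k^2+4n^2+10kn+5k+6n}{30}.$$
   Context: $\mathbb{N}=\{0,1,2,\ldots\}$. A partition is a finite weakly decreasing sequence of positive integers (the empty sequence $\emptyset$ is allowed); its size $|\lambda|$ is the sum of its parts, and it is identified with its Young diagram. An oscillating tableau of shape $\lambda$ and length $l$ is a sequence of partitions $T=(\lambda^0,\lambda^1,\ldots,\lambda^l)$ with $\lambda^0=\emptyset$, $\lambda^l=\lambda$, and, for each $0\le i\le l-1$, $\lambda^{i+1}$ obtained from $\lambda^i$ by adding one box to or removing one box from its Young diagram. $\mathcal{OT}(\lambda,l)$ denotes the set of oscillating tableaux of shape $\lambda$ and length $l$. *)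

theory Defs
  imports Complex_Main
begin

definition is_partition :: "nat list \<Rightarrow> bool" where
  "is_partition \<mu> \<longleftrightarrow> sorted_wrt (\<ge>) \<mu> \<and> (\<forall>p\<in>set \<mu>. 0 < p)"

text \<open>Boxes are (row, column) pairs, counted from 0.\<close>

definition young_diagram :: "nat list \<Rightarrow> (nat \<times> nat) set" where
  "young_diagram \<mu> = {(i, j). i < length \<mu> \<and> j < \<mu> ! i}"

definition adds_box :: "nat list \<Rightarrow> nat list \<Rightarrow> bool" where
  "adds_box \<mu> \<nu> \<longleftrightarrow>
     (\<exists>b. b \<notin> young_diagram \<mu> \<and> young_diagram \<nu> = insert b (young_diagram \<mu>))"

text \<open>
  A tableau of length \<open>l\<close> is the list of its \<open>l + 1\<close> partitions.
\<close>

definition oscillating_tableaux :: "nat list \<Rightarrow> nat \<Rightarrow> nat list list set" where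
  "oscillating_tableaux \<mu> l =
     {T. length T = l + 1 \<and> (\<forall>\<nu>\<in>set T. is_partition \<nu>) \<and> T ! 0 = [] \<and> T ! l = \<mu> \<and>
         (\<forall>i<l. adds_box (T ! i) (T ! (i + 1)) \<or> adds_box (T ! (i + 1)) (T ! i))}"

definition wt_2_0 :: "nat list list \<Rightarrow> nat" where
  "wt_2_0 T = (\<Sum>i<length T. (sum_list (T ! i))\<^sup>2)"

end

theory Submission
  imports Defs
begin

text \<open>
  Write $f^\lambda$ for the number of standard Young tableaux. The relation $DU - UD = I$ in
  Young's lattice gives $\sum_{\nu} f^\nu = (|\lambda| + 1) f^\lambda$ over the $\nu$ covering
  $\lambda$, besides $\sum_{\nu} f^\nu = f^\lambda$ over the $\nu$ covered by $\lambda$.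
  Hence the recursions on the last step of a tableau involve $\lambda$ only through $f^\lambda$,
  $k$ and $n$: the count is $c(k,n) f^\lambda$ with $c(k,n) = \binom{k+2n}{k}(2n-1)!!$, and among the
  tableaux of shape $\lambda$ the last step is an addition with probability $k/(k+2n)$ and a removal
  with probability $2n/(k+2n)$. The mean weight $P$ is therefore determined by
  $(k+2n)P(k,n) = k P(k-1,n) + 2n P(k+1,n-1) + k^2(k+2n)$, which the stated polynomial satisfies.
\<close>

section \<open>Partitions as row-length functions\<close>

text \<open>Padding with zeros makes adding or removing a box a pointwise update of a total
  function, even when a row appears or disappears.\<close>

definition rows :: "nat list \<Rightarrow> nat \<Rightarrow> nat" where
  "rows \<mu> i = (if i < length \<mu> then \<mu> ! i else 0)"

definition shape :: "(nat \<Rightarrow> nat) \<Rightarrow> bool" where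
  "shape r \<longleftrightarrow> antimono r \<and> (\<exists>n. r n = 0)"

definition of_rows :: "(nat \<Rightarrow> nat) \<Rightarrow> nat list" where
  "of_rows r = map r [0..<LEAST n. r n = 0]"

definition add_row :: "nat \<Rightarrow> (nat \<Rightarrow> nat) \<Rightarrow> nat \<Rightarrow> nat" where
  "add_row i r = r(i := r i + 1)"

text \<open>Subtraction is truncated, so on an empty row this is the identity; it removes a box only
  from a nonempty row.\<close>

definition del_row :: "nat \<Rightarrow> (nat \<Rightarrow> nat) \<Rightarrow> nat \<Rightarrow> nat" where
  "del_row i r = r(i := r i - 1)"

definition addable :: "(nat \<Rightarrow> nat) \<Rightarrow> nat set" where
  "addable r = {i. i = 0 \<or> r i < r (i - 1)}"

definition removable :: "(nat \<Rightarrow> nat) \<Rightarrow> nat set" where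
  "removable r = {i. r (Suc i) < r i}"

lemma shape_rows:
  assumes "is_partition \<mu>"
  shows "shape (rows \<mu>)"
proof -
  have "rows \<mu> j \<le> rows \<mu> i" if "i \<le> j" for i j
    using assms that sorted_wrt_nth_less[of "(\<ge>)" \<mu> i j]
    by (cases "i = j") (auto simp: rows_def is_partition_def)
  moreover have "rows \<mu> (length \<mu>) = 0" by (simp add: rows_def)
  ultimately show ?thesis unfolding shape_def antimono_def by blast
qed

lemma shape_antimono: "shape r \<Longrightarrow> i \<le> j \<Longrightarrow> r j \<le> r i"
  by (simp add: shape_def antimono_def)

lemma shape_zero: "shape r \<Longrightarrow> r i = 0 \<Longrightarrow> i \<le> j \<Longrightarrow> r j = 0"
  using shape_antimono[of r i j] by simp

lemma shape_pos_iff: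
  assumes "shape r"
  shows "i < (LEAST n. r n = 0) \<longleftrightarrow> 0 < r i"
proof -
  have "r (LEAST n. r n = 0) = 0"
    using assms LeastI_ex[of "\<lambda>n. r n = 0"] by (simp add: shape_def)
  then show ?thesis
    using not_less_Least[of i "\<lambda>n. r n = 0"] shape_zero[OF assms, of "LEAST n. r n = 0" i] by force
qed

lemma rows_of_rows: "shape r \<Longrightarrow> rows (of_rows r) = r"
  by (rule ext) (auto simp: rows_def of_rows_def shape_pos_iff)

lemma is_partition_of_rows: "shape r \<Longrightarrow> is_partition (of_rows r)"
  by (simp add: is_partition_def of_rows_def sorted_wrt_iff_nth_less shape_antimono)
    (simp add: shape_pos_iff)

lemma of_rows_rows:
  assumes "is_partition \<mu>"
  shows "of_rows (rows \<mu>) = \<mu>"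
proof -
  \<comment> \<open>Parts are positive, so the first zero of the padded function lies exactly at the
    end of the list.\<close>
  have "(LEAST n. rows \<mu> n = 0) = length \<mu>"
    using assms
    by (intro Least_equality) (auto simp: rows_def is_partition_def split: if_splits,
        metis less_irrefl not_le nth_mem)
  then show ?thesis
    by (auto simp: of_rows_def rows_def intro: nth_equalityI)
qed

lemma shape_iff_Suc: "shape r \<longleftrightarrow> (\<forall>i. r (Suc i) \<le> r i) \<and> (\<exists>n. r n = 0)"
  unfolding shape_def using decseq_SucI decseq_SucD by metis

section \<open>Adding and deleting the last box of a row\<close>

lemma shape_add_row:
  assumes "shape r"
  shows "shape (add_row i r) \<longleftrightarrow> i \<in> addable r"
proof
  assume "shape (add_row i r)"
  then have "add_row i r i \<le> add_row i r (i - 1)" by (rule shape_antimono) simp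
  then show "i \<in> addable r" by (auto simp: add_row_def addable_def split: if_splits)
next
  assume i: "i \<in> addable r"
  obtain n where "r n = 0" using assms by (auto simp: shape_def)
  then have "add_row i r (n + i + 1) = 0"
    using shape_zero[OF assms, of n "n + i + 1"] by (simp add: add_row_def)
  moreover have "add_row i r (Suc j) \<le> add_row i r j" for j
    using i assms by (auto simp: add_row_def addable_def shape_iff_Suc le_SucI)
  ultimately show "shape (add_row i r)" by (auto simp: shape_iff_Suc)
qed

lemma shape_del_row:
  assumes "shape r" "i \<in> removable r"
  shows "shape (del_row i r)"
proof -
  obtain n where "r n = 0" using assms by (auto simp: shape_def)
  then have "del_row i r n = 0" by (auto simp: del_row_def)
  moreover have "del_row i r (Suc j) \<le> del_row i r j" for j
    using assms by (auto simp: del_row_def removable_def shape_iff_Suc intro: diff_le_self le_trans)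
  ultimately show ?thesis by (auto simp: shape_iff_Suc)
qed

lemma removable_if_add_row: "shape r \<Longrightarrow> i \<in> removable (add_row i r)"
  by (auto simp: removable_def add_row_def shape_iff_Suc less_Suc_eq_le)

lemma addable_del_row: "shape r \<Longrightarrow> i \<in> removable r \<Longrightarrow> i \<in> addable (del_row i r)"
  using shape_antimono[of r "i - 1" i]
  by (auto simp: removable_def addable_def del_row_def)

lemma del_row_add_row [simp]: "del_row i (add_row i r) = r"
  by (auto simp: del_row_def add_row_def)

lemma add_row_del_row: "i \<in> removable r \<Longrightarrow> add_row i (del_row i r) = r"
  by (auto simp: del_row_def add_row_def removable_def)

lemma add_row_eq_iff: "add_row i r = add_row j r \<longleftrightarrow> i = j"
  by (auto simp: add_row_def dest!: fun_cong[of _ _ i] split: if_splits)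

text \<open>Restricting to removable rows guarantees \<open>0 < r i\<close>, so the update really
  changes entry \<open>i\<close> and thereby reveals \<open>i\<close>.\<close>

lemma inj_on_del_row: "inj_on (\<lambda>i. del_row i r) (removable r)"
proof (rule inj_onI)
  fix i j assume "i \<in> removable r" "j \<in> removable r" "del_row i r = del_row j r"
  then have "del_row i r i = del_row j r i" "0 < r i" by (auto simp: removable_def)
  then show "i = j" by (auto simp: del_row_def split: if_splits)
qed

section \<open>Counting corners, and the commutation relation for row updates\<close>

lemma finite_removable: "shape r \<Longrightarrow> finite (removable r)"
proof -
  assume r: "shape r"
  have "removable r \<subseteq> {..<LEAST n. r n = 0}"
    using r by (auto simp: removable_def shape_pos_iff)
  then show ?thesis by (rule finite_subset) simp
qed

text \<open>A drop from row \<open>i\<close> to row \<open>Suc i\<close> makes row \<open>i\<close>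
  removable and row \<open>Suc i\<close> addable at once; row 0 is always addable. This one extra
  corner is the source of the \<open>I\<close> in \<open>DU - UD = I\<close>.\<close>

lemma addable_eq: "addable r = insert 0 (Suc ` removable r)"
proof -
  have "i \<in> addable r \<longleftrightarrow> i \<in> insert 0 (Suc ` removable r)" for i
    by (cases i) (auto simp: addable_def removable_def)
  then show ?thesis by blast
qed

lemma finite_addable: "shape r \<Longrightarrow> finite (addable r)"
  by (simp add: addable_eq finite_removable)

lemma card_addable: "shape r \<Longrightarrow> card (addable r) = card (removable r) + 1"
  by (simp add: addable_eq finite_removable card_image)

text \<open>For distinct rows the two conditions interact only when \<open>i = Suc j\<close>; then
  both sides say that row \<open>j\<close> exceeds row \<open>i\<close> by at least two.\<close>

lemma add_del_commute:
  assumes "i \<noteq> j"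
  shows "i \<in> addable r \<and> j \<in> removable (add_row i r) \<longleftrightarrow>
         j \<in> removable r \<and> i \<in> addable (del_row j r)"
  using assms by (cases i) (auto simp: addable_def removable_def add_row_def del_row_def)

lemma del_row_add_row_commute:
  "i \<noteq> j \<Longrightarrow> del_row j (add_row i r) = add_row i (del_row j r)"
  by (auto simp: del_row_def add_row_def)

text \<open>Off the diagonal \<open>i = j\<close> the two double sums agree by commutation. The
  diagonal contributes \<open>g r\<close> once per addable row on the left and once per removable
  row on the right.\<close>

lemma sum_add_del:
  fixes g :: "(nat \<Rightarrow> nat) \<Rightarrow> nat"
  assumes r: "shape r"
  shows "(\<Sum>i\<in>addable r. \<Sum>j\<in>removable (add_row i r). g (del_row j (add_row i r))) =
         (\<Sum>j\<in>removable r. \<Sum>i\<in>addable (del_row j r). g (add_row i (del_row j r))) + g r"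
proof -
  have fin_rem: "finite (removable (add_row i r))" if "i \<in> addable r" for i
    using r that by (intro finite_removable) (simp add: shape_add_row)
  have fin_add: "finite (addable (del_row j r))" if "j \<in> removable r" for j
    using r that by (intro finite_addable shape_del_row)
  \<comment> \<open>The term \<open>j = i\<close> undoes the addition and is split off as
    \<open>g r\<close>.\<close>
  have "(\<Sum>i\<in>addable r. \<Sum>j\<in>removable (add_row i r). g (del_row j (add_row i r))) =
        (\<Sum>i\<in>addable r. g r + (\<Sum>j\<in>removable (add_row i r) - {i}. g (del_row j (add_row i r))))"
    using r by (intro sum.cong refl)
      (simp add: sum.remove[OF fin_rem removable_if_add_row])
  also have "\<dots> = card (addable r) * g r +
      (\<Sum>(i, j)\<in>Sigma (addable r) (\<lambda>i. removable (add_row i r) - {i}). g (del_row j (add_row i r)))"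
    using r by (simp add: sum.distrib finite_addable fin_rem sum.Sigma)
  also have "(\<Sum>(i, j)\<in>Sigma (addable r) (\<lambda>i. removable (add_row i r) - {i}). g (del_row j (add_row i r)))
      = (\<Sum>(j, i)\<in>Sigma (removable r) (\<lambda>j. addable (del_row j r) - {j}). g (add_row i (del_row j r)))"
    (is "sum _ ?S = sum _ ?S'")
  proof -
    have mem: "(i, j) \<in> ?S \<longleftrightarrow> (j, i) \<in> ?S'" for i j
      using add_del_commute[of i j r] by (cases "i = j") auto
    show ?thesis
    proof (rule sum.reindex_bij_witness[of _ prod.swap prod.swap])
      fix x assume "x \<in> ?S"
      then show "(case prod.swap x of (j, i) \<Rightarrow> g (add_row i (del_row j r))) =
          (case x of (i, j) \<Rightarrow> g (del_row j (add_row i r)))"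
        using del_row_add_row_commute[of "fst x" "snd x" r] by (cases x) auto
    next
      fix x assume "x \<in> ?S"
      then show "prod.swap x \<in> ?S'" using mem[of "fst x" "snd x"] by (simp add: prod.swap_def)
    next
      fix x assume "x \<in> ?S'"
      then show "prod.swap x \<in> ?S" using mem[of "snd x" "fst x"] by (simp add: prod.swap_def)
    qed simp_all
  qed
  \<comment> \<open>By \<open>card_addable\<close> one copy of \<open>g r\<close> stays outside, and
    the others are distributed one to each removable row.\<close>
  also have "card (addable r) * g r + \<dots> = g r +
      (\<Sum>j\<in>removable r. g r + (\<Sum>i\<in>addable (del_row j r) - {j}. g (add_row i (del_row j r))))"
    using r by (simp add: sum.distrib finite_removable fin_add sum.Sigma card_addable)
  \<comment> \<open>Each distributed \<open>g r\<close> is reabsorbed as the term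
    \<open>i = j\<close>, where the deleted box is put back.\<close>
  also have "(\<Sum>j\<in>removable r. g r + (\<Sum>i\<in>addable (del_row j r) - {j}. g (add_row i (del_row j r))))
      = (\<Sum>j\<in>removable r. \<Sum>i\<in>addable (del_row j r). g (add_row i (del_row j r)))"
    using r by (intro sum.cong refl)
      (simp add: sum.remove[OF fin_add addable_del_row] add_row_del_row)
  finally show ?thesis by simp
qed

section \<open>Covers in Young's lattice\<close>

definition upper_covers :: "nat list \<Rightarrow> nat list set" where
  "upper_covers \<mu> = {\<nu>. is_partition \<nu> \<and> adds_box \<mu> \<nu>}"

definition lower_covers :: "nat list \<Rightarrow> nat list set" where
  "lower_covers \<mu> = {\<nu>. is_partition \<nu> \<and> adds_box \<nu> \<mu>}"

lemma young_diagram_rows: "young_diagram \<mu> = {(i, j). j < rows \<mu> i}"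
  by (auto simp: young_diagram_def rows_def split: if_splits)

lemma adds_box_iff: "adds_box \<mu> \<nu> \<longleftrightarrow> (\<exists>i. rows \<nu> = add_row i (rows \<mu>))"
proof
  assume "adds_box \<mu> \<nu>"
  then obtain i j where b: "(i, j) \<notin> young_diagram \<mu>"
    "young_diagram \<nu> = insert (i, j) (young_diagram \<mu>)"
    by (auto simp: adds_box_def)
  have *: "b < rows \<nu> a \<longleftrightarrow> (a = i \<and> b = j) \<or> b < rows \<mu> a" for a b
    using b(2) unfolding young_diagram_rows set_eq_iff by force
  have ge: "rows \<mu> i \<le> j" using b(1) by (simp add: young_diagram_rows)
  have "rows \<nu> a = rows \<mu> a" if "a \<noteq> i" for a
    using *[of "rows \<mu> a" a] *[of "rows \<nu> a" a] that by auto
  moreover have "rows \<nu> i = Suc (rows \<mu> i)"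
  proof -
    \<comment> \<open>Column \<open>j\<close> shows that row \<open>i\<close> grew, column
      \<open>rows \<mu> i\<close> identifies the new box, and the next column shows that no second
      box was added.\<close>
    have "rows \<mu> i < rows \<nu> i" using *[of j i] ge by auto
    moreover from this have "j = rows \<mu> i" using *[of "rows \<mu> i" i] by auto
    ultimately show ?thesis using *[of "Suc (rows \<mu> i)" i] by auto
  qed
  ultimately have "rows \<nu> = add_row i (rows \<mu>)" by (auto simp: add_row_def)
  then show "\<exists>i. rows \<nu> = add_row i (rows \<mu>)" ..
next
  assume "\<exists>i. rows \<nu> = add_row i (rows \<mu>)"
  then obtain i where "rows \<nu> = add_row i (rows \<mu>)" ..
  then show "adds_box \<mu> \<nu>" unfolding adds_box_def
    by (intro exI[of _ "(i, rows \<mu> i)"]) (auto simp: young_diagram_rows add_row_def split: if_splits)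
qed

lemma upper_covers_eq:
  assumes "is_partition \<mu>"
  shows "upper_covers \<mu> = (\<lambda>i. of_rows (add_row i (rows \<mu>))) ` addable (rows \<mu>)"
proof (intro equalityI subsetI)
  fix \<nu> assume "\<nu> \<in> upper_covers \<mu>"
  then obtain i where i: "is_partition \<nu>" "rows \<nu> = add_row i (rows \<mu>)"
    by (auto simp: upper_covers_def adds_box_iff)
  then have "i \<in> addable (rows \<mu>)" using assms shape_rows shape_add_row by metis
  moreover have "\<nu> = of_rows (add_row i (rows \<mu>))" using i of_rows_rows by metis
  ultimately show "\<nu> \<in> (\<lambda>i. of_rows (add_row i (rows \<mu>))) ` addable (rows \<mu>)" by blast
qed (use assms in \<open>auto simp: upper_covers_def adds_box_iff shape_add_row shape_rows
  rows_of_rows is_partition_of_rows\<close>)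

lemma lower_covers_eq:
  assumes "is_partition \<mu>"
  shows "lower_covers \<mu> = (\<lambda>i. of_rows (del_row i (rows \<mu>))) ` removable (rows \<mu>)"
proof (intro equalityI subsetI)
  fix \<nu> assume "\<nu> \<in> lower_covers \<mu>"
  then obtain i where i: "is_partition \<nu>" "rows \<mu> = add_row i (rows \<nu>)"
    by (auto simp: lower_covers_def adds_box_iff)
  then have "i \<in> removable (rows \<mu>)" using shape_rows removable_if_add_row by metis
  moreover have "\<nu> = of_rows (del_row i (rows \<mu>))" using i of_rows_rows by simp
  ultimately show "\<nu> \<in> (\<lambda>i. of_rows (del_row i (rows \<mu>))) ` removable (rows \<mu>)" by blast
next
  fix \<nu> assume "\<nu> \<in> (\<lambda>i. of_rows (del_row i (rows \<mu>))) ` removable (rows \<mu>)"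
  then obtain i where i: "i \<in> removable (rows \<mu>)" "\<nu> = of_rows (del_row i (rows \<mu>))" by blast
  then have "shape (del_row i (rows \<mu>))" using assms shape_rows shape_del_row by blast
  then show "\<nu> \<in> lower_covers \<mu>"
    using i by (auto simp: lower_covers_def adds_box_iff rows_of_rows is_partition_of_rows
        add_row_del_row intro!: exI[of _ i])
qed

lemma finite_upper_covers: "is_partition \<mu> \<Longrightarrow> finite (upper_covers \<mu>)"
  by (simp add: upper_covers_eq finite_addable shape_rows)

lemma finite_lower_covers: "is_partition \<mu> \<Longrightarrow> finite (lower_covers \<mu>)"
  by (simp add: lower_covers_eq finite_removable shape_rows)

lemma sum_upper_covers:
  assumes "is_partition \<mu>"
  shows "sum g (upper_covers \<mu>) = (\<Sum>i\<in>addable (rows \<mu>). g (of_rows (add_row i (rows \<mu>))))"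
proof -
  have "inj_on (\<lambda>i. of_rows (add_row i (rows \<mu>))) (addable (rows \<mu>))"
    using assms by (intro inj_onI) (metis add_row_eq_iff rows_of_rows shape_add_row shape_rows)
  then show ?thesis by (simp add: upper_covers_eq[OF assms] sum.reindex)
qed

lemma sum_lower_covers:
  assumes "is_partition \<mu>"
  shows "sum g (lower_covers \<mu>) = (\<Sum>i\<in>removable (rows \<mu>). g (of_rows (del_row i (rows \<mu>))))"
proof -
  have "inj_on (\<lambda>i. of_rows (del_row i (rows \<mu>))) (removable (rows \<mu>))"
    using assms inj_on_del_row[of "rows \<mu>"]
    by (intro inj_onI) (metis inj_onD rows_of_rows shape_del_row shape_rows)
  then show ?thesis by (simp add: lower_covers_eq[OF assms] sum.reindex)
qed

text \<open>The relation $DU - UD = I$ of Young's lattice.\<close>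

lemma sum_upper_lower_covers:
  fixes g :: "nat list \<Rightarrow> nat"
  assumes "is_partition \<mu>"
  shows "(\<Sum>\<nu>\<in>upper_covers \<mu>. sum g (lower_covers \<nu>)) =
         (\<Sum>\<nu>\<in>lower_covers \<mu>. sum g (upper_covers \<nu>)) + g \<mu>"
proof -
  have sh: "shape (rows \<mu>)" using assms by (rule shape_rows)
  have "(\<Sum>\<nu>\<in>upper_covers \<mu>. sum g (lower_covers \<nu>)) =
      (\<Sum>i\<in>addable (rows \<mu>). \<Sum>j\<in>removable (add_row i (rows \<mu>)).
        g (of_rows (del_row j (add_row i (rows \<mu>)))))"
    by (simp add: sum_upper_covers[OF assms])
      (intro sum.cong refl, simp add: sum_lower_covers is_partition_of_rows rows_of_rows shape_add_row sh)
  also have "\<dots> = (\<Sum>j\<in>removable (rows \<mu>). \<Sum>i\<in>addable (del_row j (rows \<mu>)).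
        g (of_rows (add_row i (del_row j (rows \<mu>))))) + g \<mu>"
    using sum_add_del[OF sh, of "g \<circ> of_rows"] by (simp add: of_rows_rows[OF assms])
  also have "(\<Sum>j\<in>removable (rows \<mu>). \<Sum>i\<in>addable (del_row j (rows \<mu>)).
        g (of_rows (add_row i (del_row j (rows \<mu>))))) = (\<Sum>\<nu>\<in>lower_covers \<mu>. sum g (upper_covers \<nu>))"
    by (simp add: sum_lower_covers[OF assms])
      (intro sum.cong refl, simp add: sum_upper_covers is_partition_of_rows rows_of_rows shape_del_row sh)
  finally show ?thesis .
qed

section \<open>Sizes of covers, and existence of lower covers\<close>

lemma young_diagram_Sigma: "young_diagram \<mu> = Sigma {..<length \<mu>} (\<lambda>i. {..<\<mu> ! i})"
  by (auto simp: young_diagram_def)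

lemma finite_young_diagram: "finite (young_diagram \<mu>)"
  by (simp add: young_diagram_Sigma)

lemma card_young_diagram: "card (young_diagram \<mu>) = sum_list \<mu>"
  by (simp add: young_diagram_Sigma sum_list_sum_nth atLeast0LessThan)

lemma sum_list_adds_box: "adds_box \<mu> \<nu> \<Longrightarrow> sum_list \<nu> = Suc (sum_list \<mu>)"
  unfolding adds_box_def
  by (metis card_insert_disjoint card_young_diagram finite_young_diagram)

lemma upper_coversD:
  "\<nu> \<in> upper_covers \<mu> \<Longrightarrow> is_partition \<nu> \<and> sum_list \<nu> = Suc (sum_list \<mu>)"
  by (auto simp: upper_covers_def sum_list_adds_box)

lemma lower_coversD:
  "\<nu> \<in> lower_covers \<mu> \<Longrightarrow> is_partition \<nu> \<and> sum_list \<mu> = Suc (sum_list \<nu>)"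
  by (auto simp: lower_covers_def sum_list_adds_box)

lemma lower_covers_nonempty:
  assumes "is_partition \<mu>" "0 < sum_list \<mu>"
  shows "lower_covers \<mu> \<noteq> {}"
proof
  assume "lower_covers \<mu> = {}"
  \<comment> \<open>With no removable row the lengths never drop, so the positive first row would
    persist to the index \<open>length \<mu>\<close>, where the padding is zero.\<close>
  then have "rows \<mu> i \<le> rows \<mu> (Suc i)" for i
    using lower_covers_eq[OF assms(1)] by (auto simp: removable_def not_less)
  then have "rows \<mu> 0 \<le> rows \<mu> (length \<mu>)"
    by (rule lift_Suc_mono_le) simp
  moreover have "\<mu> \<noteq> []" using assms(2) by auto
  ultimately show False using assms(1)
    by (cases \<mu>) (auto simp: rows_def is_partition_def)
qed

section \<open>Counting\<close>

text \<open>For a partition of size \<open>m\<close>, the number of standard Young tableaux of that shape.\<close>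

fun down_chains :: "nat \<Rightarrow> nat list \<Rightarrow> nat" where
  "down_chains 0 \<mu> = 1"
| "down_chains (Suc m) \<mu> = (\<Sum>\<nu>\<in>lower_covers \<mu>. down_chains m \<nu>)"

lemma down_chains_pos:
  "is_partition \<mu> \<Longrightarrow> sum_list \<mu> = m \<Longrightarrow> 0 < down_chains m \<mu>"
proof (induction m arbitrary: \<mu>)
  case (Suc m)
  then have "lower_covers \<mu> \<noteq> {}" by (intro lower_covers_nonempty) auto
  moreover have "0 < down_chains m \<nu>" if "\<nu> \<in> lower_covers \<mu>" for \<nu>
    using Suc lower_coversD[OF that] by simp
  ultimately show ?case
    using Suc.prems finite_lower_covers by (auto intro!: sum_pos)
qed simp

text \<open>Applying \<open>DU = UD + I\<close> to the chain counts, \<open>UD\<close> yields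
  \<open>m\<close> copies by induction on the size \<open>m\<close>, and \<open>I\<close> yields one
  more.\<close>

lemma sum_upper_covers_down_chains:
  "is_partition \<mu> \<Longrightarrow> sum_list \<mu> = m \<Longrightarrow>
   (\<Sum>\<nu>\<in>upper_covers \<mu>. down_chains (Suc m) \<nu>) = Suc m * down_chains m \<mu>"
proof (induction m arbitrary: \<mu>)
  case 0
  then have "lower_covers \<mu> = {}" using lower_coversD by fastforce
  \<comment> \<open>At size 1 the chain count is the number of lower covers, hence the constant
    function 1.\<close>
  then show ?case using sum_upper_lower_covers[of \<mu> "\<lambda>_. 1"] 0 by simp
next
  case (Suc m)
  have "(\<Sum>\<nu>\<in>upper_covers \<mu>. down_chains (Suc (Suc m)) \<nu>) =
      (\<Sum>\<nu>\<in>lower_covers \<mu>. sum (down_chains (Suc m)) (upper_covers \<nu>)) + down_chains (Suc m) \<mu>"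
    using sum_upper_lower_covers[of \<mu> "down_chains (Suc m)"] Suc.prems by simp
  \<comment> \<open>Lower covers have size \<open>m\<close>, so the induction hypothesis evaluates
    each inner sum.\<close>
  also have "(\<Sum>\<nu>\<in>lower_covers \<mu>. sum (down_chains (Suc m)) (upper_covers \<nu>)) =
      (\<Sum>\<nu>\<in>lower_covers \<mu>. Suc m * down_chains m \<nu>)"
    using Suc lower_coversD by (intro sum.cong refl) auto
  also have "\<dots> = Suc m * down_chains (Suc m) \<mu>" by (simp add: sum_distrib_left)
  finally show ?case by simp
qed

section \<open>Decomposing oscillating tableaux by their last step\<close>

lemma oscillating_tableaux_0: "oscillating_tableaux \<mu> 0 = (if \<mu> = [] then {[[]]} else {})"
  by (auto simp: oscillating_tableaux_def is_partition_def length_Suc_conv)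

lemma oscillating_tableaux_Suc:
  assumes "is_partition \<mu>"
  shows "oscillating_tableaux \<mu> (Suc l) =
    (\<Union>\<nu>\<in>upper_covers \<mu> \<union> lower_covers \<mu>. (\<lambda>T. T @ [\<mu>]) ` oscillating_tableaux \<nu> l)"
proof (intro equalityI subsetI)
  fix T assume T: "T \<in> oscillating_tableaux \<mu> (Suc l)"
  then have "T \<noteq> []" by (auto simp: oscillating_tableaux_def)
  then obtain S \<nu>' where S: "T = S @ [\<nu>']" by (metis rev_exhaust)
  have len: "length S = Suc l" using T S by (simp add: oscillating_tableaux_def)
  have [simp]: "\<nu>' = \<mu>" using T S len by (auto simp: oscillating_tableaux_def nth_append)
  have step: "adds_box (T ! i) (T ! (i + 1)) \<or> adds_box (T ! (i + 1)) (T ! i)" if "i < Suc l" for i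
    using T that by (auto simp: oscillating_tableaux_def)
  have "adds_box (S ! i) (S ! (i + 1)) \<or> adds_box (S ! (i + 1)) (S ! i)" if "i < l" for i
    using step[of i] that S len by (simp add: nth_append)
  then have "S \<in> oscillating_tableaux (S ! l) l"
    using T S len by (auto simp: oscillating_tableaux_def nth_append)
  moreover have "S ! l \<in> upper_covers \<mu> \<union> lower_covers \<mu>"
    using step[of l] T S len
    by (auto simp: oscillating_tableaux_def nth_append upper_covers_def lower_covers_def)
  ultimately show "T \<in> (\<Union>\<nu>\<in>upper_covers \<mu> \<union> lower_covers \<mu>. (\<lambda>T. T @ [\<mu>]) ` oscillating_tableaux \<nu> l)"
    using S by auto
next
  fix T assume "T \<in> (\<Union>\<nu>\<in>upper_covers \<mu> \<union> lower_covers \<mu>. (\<lambda>T. T @ [\<mu>]) ` oscillating_tableaux \<nu> l)"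
  then obtain \<nu> S where \<nu>: "adds_box \<mu> \<nu> \<or> adds_box \<nu> \<mu>"
    and S: "S \<in> oscillating_tableaux \<nu> l" and T: "T = S @ [\<mu>]"
    by (auto simp: upper_covers_def lower_covers_def)
  have len: "length S = Suc l" "S ! l = \<nu>" using S by (auto simp: oscillating_tableaux_def)
  have "adds_box (T ! i) (T ! (i + 1)) \<or> adds_box (T ! (i + 1)) (T ! i)" if "i < Suc l" for i
  proof (cases "i = l")
    case True
    then show ?thesis using \<nu> T len by (auto simp: nth_append)
  next
    case False
    then show ?thesis using S T that len by (auto simp: nth_append oscillating_tableaux_def)
  qed
  then show "T \<in> oscillating_tableaux \<mu> (Suc l)"
    using S T len assms by (auto simp: oscillating_tableaux_def nth_append)
qed

lemma finite_oscillating_tableaux: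
  "is_partition \<mu> \<Longrightarrow> finite (oscillating_tableaux \<mu> l)"
proof (induction l arbitrary: \<mu>)
  case (Suc l)
  then show ?case
    using upper_coversD lower_coversD
    by (auto simp: oscillating_tableaux_Suc finite_upper_covers finite_lower_covers)
qed (simp add: oscillating_tableaux_0)

lemma sum_oscillating_tableaux_Suc:
  fixes h :: "nat list list \<Rightarrow> real"
  assumes "is_partition \<mu>"
  shows "sum h (oscillating_tableaux \<mu> (Suc l)) =
    (\<Sum>\<nu>\<in>upper_covers \<mu>. \<Sum>T\<in>oscillating_tableaux \<nu> l. h (T @ [\<mu>])) +
    (\<Sum>\<nu>\<in>lower_covers \<mu>. \<Sum>T\<in>oscillating_tableaux \<nu> l. h (T @ [\<mu>]))"
proof -
  \<comment> \<open>The next-to-last partition of the extended tableau recovers the cover it came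
    from.\<close>
  have "(\<lambda>T. T @ [\<mu>]) ` oscillating_tableaux \<nu> l \<inter> (\<lambda>T. T @ [\<mu>]) ` oscillating_tableaux \<nu>' l = {}"
    if "\<nu> \<noteq> \<nu>'" for \<nu> \<nu>'
    using that by (auto simp: oscillating_tableaux_def)
  moreover have "finite (oscillating_tableaux \<nu> l)" if "\<nu> \<in> upper_covers \<mu> \<union> lower_covers \<mu>" for \<nu>
    using that upper_coversD lower_coversD finite_oscillating_tableaux by blast
  ultimately have "sum h (oscillating_tableaux \<mu> (Suc l)) =
      (\<Sum>\<nu>\<in>upper_covers \<mu> \<union> lower_covers \<mu>. sum h ((\<lambda>T. T @ [\<mu>]) ` oscillating_tableaux \<nu> l))"
    unfolding oscillating_tableaux_Suc[OF assms]
    using assms by (intro sum.UNION_disjoint) (auto simp: finite_upper_covers finite_lower_covers)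
  also have "\<dots> = (\<Sum>\<nu>\<in>upper_covers \<mu> \<union> lower_covers \<mu>. \<Sum>T\<in>oscillating_tableaux \<nu> l. h (T @ [\<mu>]))"
    by (simp add: sum.reindex inj_on_def)
  also have "\<dots> = (\<Sum>\<nu>\<in>upper_covers \<mu>. \<Sum>T\<in>oscillating_tableaux \<nu> l. h (T @ [\<mu>])) +
      (\<Sum>\<nu>\<in>lower_covers \<mu>. \<Sum>T\<in>oscillating_tableaux \<nu> l. h (T @ [\<mu>]))"
  proof (rule sum.union_disjoint)
    show "upper_covers \<mu> \<inter> lower_covers \<mu> = {}"
      using upper_coversD lower_coversD by fastforce
  qed (use assms in \<open>auto simp: finite_upper_covers finite_lower_covers\<close>)
  finally show ?thesis .
qed

lemma wt_2_0_snoc: "wt_2_0 (T @ [\<mu>]) = wt_2_0 T + (sum_list \<mu>)\<^sup>2"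
  by (simp add: wt_2_0_def nth_append)

text \<open>Each step changes the size by one, so \<open>l\<close> steps cannot exceed size
  \<open>l\<close>. This removes the upper covers from the recursion at
  \<open>n = 0\<close>.\<close>

lemma oscillating_tableaux_empty:
  "is_partition \<mu> \<Longrightarrow> l < sum_list \<mu> \<Longrightarrow> oscillating_tableaux \<mu> l = {}"
proof (induction l arbitrary: \<mu>)
  case (Suc l)
  have "oscillating_tableaux \<nu> l = {}" if "\<nu> \<in> upper_covers \<mu> \<union> lower_covers \<mu>" for \<nu>
  proof (rule Suc.IH)
    show "is_partition \<nu>" using that upper_coversD lower_coversD by blast
    show "l < sum_list \<nu>"
      using that upper_coversD[of \<nu> \<mu>] lower_coversD[of \<nu> \<mu>] Suc.prems(2) by auto
  qed
  then show ?case by (simp add: oscillating_tableaux_Suc[OF Suc.prems(1)])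
qed (auto simp: oscillating_tableaux_0)

section \<open>Closed forms for the count and the mean weight\<close>

text \<open>\<open>osc_coeff k n\<close> is $\binom{k+2n}{k}\,(2n-1)!!$.\<close>

definition osc_coeff :: "nat \<Rightarrow> nat \<Rightarrow> real" where
  "osc_coeff k n = fact (k + 2 * n) / (fact k * fact n * 2 ^ n)"

text \<open>Real arguments make \<open>k - 1\<close> and \<open>n - 1\<close> genuine subtractions,
  so the recursion is a polynomial identity also at \<open>k = 0\<close> and \<open>n = 0\<close>,
  where the shifted values have factor zero.\<close>

definition mean_weight :: "real \<Rightarrow> real \<Rightarrow> real" where
  "mean_weight k n = (k + 2 * n + 1) * ((10 * k\<^sup>2 + 4 * n\<^sup>2 + 10 * k * n + 5 * k + 6 * n) / 30)"

lemma osc_coeff_pos: "0 < osc_coeff k n"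
  by (simp add: osc_coeff_def)

text \<open>This encodes the probability that the last step is an addition, with
  \<open>Suc k\<close> as the final size.\<close>

lemma osc_coeff_lower:
  "osc_coeff k n = osc_coeff (Suc k) n * real (Suc k) / (real (Suc k) + 2 * real n)"
proof -
  have "real (Suc k) + 2 * real n = real (Suc (k + 2 * n))" by simp
  then show ?thesis by (simp add: osc_coeff_def divide_simps del: of_nat_Suc)
qed

text \<open>This encodes the probability that the last step is a removal; the factor
  \<open>Suc k\<close> on the left comes from \<open>sum_upper_covers_down_chains\<close>.\<close>

lemma osc_coeff_upper:
  "real (Suc k) * osc_coeff (Suc k) n =
   osc_coeff k (Suc n) * (2 * real (Suc n)) / (real k + 2 * real (Suc n))"
proof -
  have "real k + 2 * real (Suc n) = real (Suc (Suc (k + 2 * n)))" by simp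
  then show ?thesis by (simp add: osc_coeff_def divide_simps del: of_nat_Suc)
qed

lemma mean_weight_rec:
  "(k + 2 * n) * mean_weight k n =
   k * mean_weight (k - 1) n + 2 * n * mean_weight (k + 1) (n - 1) + k\<^sup>2 * (k + 2 * n)"
  unfolding mean_weight_def by (simp add: field_simps power2_eq_square)

text \<open>The case of constant \<open>p\<close> counts tableaux, the case \<open>p = mean_weight\<close> sums weights.\<close>

lemma cover_sums:
  fixes p :: "real \<Rightarrow> real \<Rightarrow> real" and s :: "nat list \<Rightarrow> real"
  assumes \<mu>: "is_partition \<mu>" "sum_list \<mu> = k" and pos: "0 < k + 2 * n"
    and s: "\<And>\<nu> m. is_partition \<nu> \<Longrightarrow> Suc (sum_list \<nu> + 2 * m) = k + 2 * n \<Longrightarrow>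
      s \<nu> = osc_coeff (sum_list \<nu>) m * real (down_chains (sum_list \<nu>) \<nu>) * p (real (sum_list \<nu>)) m"
    and s0: "\<And>\<nu>. is_partition \<nu> \<Longrightarrow> k + 2 * n \<le> sum_list \<nu> \<Longrightarrow> s \<nu> = 0"
  shows "(sum s (upper_covers \<mu>) + sum s (lower_covers \<mu>)) * (real k + 2 * real n) =
    osc_coeff k n * real (down_chains k \<mu>) * (real k * p (real k - 1) n + 2 * real n * p (real k + 1) (real n - 1))"
proof -
  have "sum s (upper_covers \<mu>) * (real k + 2 * real n) =
      osc_coeff k n * real (down_chains k \<mu>) * (2 * n * p (real k + 1) (real n - 1))"
  proof (cases n)
    case 0
    \<comment> \<open>For \<open>n = 0\<close> an upper cover has size \<open>k + 1\<close>, above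
      the bound in \<open>s0\<close>; the right side vanishes through its factor
      \<open>n\<close>.\<close>
    then have "s \<nu> = 0" if "\<nu> \<in> upper_covers \<mu>" for \<nu>
      using upper_coversD[OF that] s0 \<mu> by simp
    then show ?thesis using 0 by simp
  next
    case (Suc m)
    \<comment> \<open>Going up raises the size by one while the length drops by one, so
      \<open>n\<close> drops to \<open>m\<close>; going down keeps \<open>n\<close>.\<close>
    have "s \<nu> = osc_coeff (Suc k) m * p (Suc k) m * real (down_chains (Suc k) \<nu>)"
      if "\<nu> \<in> upper_covers \<mu>" for \<nu>
      using upper_coversD[OF that] s[of \<nu> m] \<mu> Suc by simp
    then have "sum s (upper_covers \<mu>) =
        osc_coeff (Suc k) m * p (Suc k) m * real (\<Sum>\<nu>\<in>upper_covers \<mu>. down_chains (Suc k) \<nu>)"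
      by (simp add: sum_distrib_left del: down_chains.simps)
    also have "\<dots> = (real (Suc k) * osc_coeff (Suc k) m) * p (Suc k) m * real (down_chains k \<mu>)"
      unfolding sum_upper_covers_down_chains[OF \<mu>] of_nat_mult by (simp only: mult_ac)
    finally show ?thesis
      unfolding osc_coeff_upper using Suc by (simp add: divide_simps add_ac)
  qed
  moreover have "sum s (lower_covers \<mu>) * (real k + 2 * real n) =
      osc_coeff k n * real (down_chains k \<mu>) * (k * p (real k - 1) n)"
  proof (cases k)
    case 0
    \<comment> \<open>The factor \<open>k\<close> likewise discards the value of \<open>p\<close> at
      -1.\<close>
    then have "lower_covers \<mu> = {}" using lower_coversD \<mu> by fastforce
    then show ?thesis using 0 by simp
  next
    case (Suc j)
    have "s \<nu> = osc_coeff j n * p j n * real (down_chains j \<nu>)"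
      if "\<nu> \<in> lower_covers \<mu>" for \<nu>
      using lower_coversD[OF that] s[of \<nu> n] \<mu> Suc by simp
    then have "sum s (lower_covers \<mu>) = osc_coeff j n * p j n * real (down_chains k \<mu>)"
      by (simp add: Suc sum_distrib_left)
    then show ?thesis
      unfolding osc_coeff_lower[of j] using Suc by (simp add: divide_simps)
  qed
  ultimately show ?thesis by (simp add: algebra_simps)
qed

text \<open>Induction on the length, with \<open>n\<close> arbitrary because upper covers need the
  hypothesis at \<open>n - 1\<close>. The constant \<open>p = 1\<close> turns the right side of
  \<open>cover_sums\<close> into a multiple of \<open>k + 2 * n\<close>, which cancels.\<close>

lemma card_oscillating_tableaux:
  "is_partition \<mu> \<Longrightarrow> l = sum_list \<mu> + 2 * n \<Longrightarrow>
   real (card (oscillating_tableaux \<mu> l)) =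
     osc_coeff (sum_list \<mu>) n * real (down_chains (sum_list \<mu>) \<mu>)"
proof (induction l arbitrary: \<mu> n)
  case 0
  then have "\<mu> = []" by (cases \<mu>) (auto simp: is_partition_def)
  then show ?case using 0 by (simp add: oscillating_tableaux_0 osc_coeff_def)
next
  case (Suc l)
  let ?k = "sum_list \<mu>"
  let ?s = "\<lambda>\<nu>. real (card (oscillating_tableaux \<nu> l))"
  have "(sum ?s (upper_covers \<mu>) + sum ?s (lower_covers \<mu>)) * (real ?k + 2 * real n) =
      osc_coeff ?k n * real (down_chains ?k \<mu>) * (real ?k * 1 + 2 * real n * 1)"
  proof (rule cover_sums[where p = "\<lambda>_ _. 1"])
    fix \<nu> m assume "is_partition \<nu>" "Suc (sum_list \<nu> + 2 * m) = ?k + 2 * n"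
    then show "?s \<nu> = osc_coeff (sum_list \<nu>) m * real (down_chains (sum_list \<nu>) \<nu>) * 1"
      using Suc.IH[of \<nu> m] Suc.prems by simp
  qed (use Suc.prems oscillating_tableaux_empty in auto)
  moreover have "real (card (oscillating_tableaux \<mu> (Suc l))) =
      sum ?s (upper_covers \<mu>) + sum ?s (lower_covers \<mu>)"
    using sum_oscillating_tableaux_Suc[OF Suc.prems(1), of "\<lambda>_. 1" l] by simp
  moreover have "real ?k + 2 * real n \<noteq> 0"
    using Suc.prems by linarith
  ultimately show ?case by simp
qed

lemma sum_wt_oscillating_tableaux:
  "is_partition \<mu> \<Longrightarrow> l = sum_list \<mu> + 2 * n \<Longrightarrow>
   (\<Sum>T\<in>oscillating_tableaux \<mu> l. real (wt_2_0 T)) =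
     osc_coeff (sum_list \<mu>) n * real (down_chains (sum_list \<mu>) \<mu>) * mean_weight (real (sum_list \<mu>)) n"
proof (induction l arbitrary: \<mu> n)
  case 0
  then have "\<mu> = []" by (cases \<mu>) (auto simp: is_partition_def)
  then show ?case using 0 by (simp add: oscillating_tableaux_0 wt_2_0_def mean_weight_def)
next
  case (Suc l)
  let ?k = "sum_list \<mu>" and ?c = "osc_coeff (sum_list \<mu>) n * real (down_chains (sum_list \<mu>) \<mu>)"
  let ?s = "\<lambda>\<nu>. \<Sum>T\<in>oscillating_tableaux \<nu> l. real (wt_2_0 T)"
  \<comment> \<open>Appending \<mu> adds the square of its size once per tableau, so the total count
    \<open>?c\<close> multiplies that square.\<close>
  have card: "(\<Sum>\<nu>\<in>upper_covers \<mu>. real (card (oscillating_tableaux \<nu> l))) +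
      (\<Sum>\<nu>\<in>lower_covers \<mu>. real (card (oscillating_tableaux \<nu> l))) = ?c"
    using sum_oscillating_tableaux_Suc[of \<mu> "\<lambda>_. 1" l] card_oscillating_tableaux[of \<mu> "Suc l" n]
      Suc.prems by simp
  have "(\<Sum>T\<in>oscillating_tableaux \<mu> (Suc l). real (wt_2_0 T)) =
      sum ?s (upper_covers \<mu>) + sum ?s (lower_covers \<mu>) + ?c * (real ?k)\<^sup>2"
    unfolding sum_oscillating_tableaux_Suc[OF Suc.prems(1)] card[symmetric]
    by (simp add: wt_2_0_snoc sum.distrib sum_distrib_right distrib_right)
  moreover have "(sum ?s (upper_covers \<mu>) + sum ?s (lower_covers \<mu>)) * (real ?k + 2 * real n) =
      ?c * (real ?k * mean_weight (real ?k - 1) n + 2 * real n * mean_weight (real ?k + 1) (real n - 1))"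
  proof (rule cover_sums[where p = mean_weight])
    fix \<nu> m assume "is_partition \<nu>" "Suc (sum_list \<nu> + 2 * m) = ?k + 2 * n"
    then show "?s \<nu> = osc_coeff (sum_list \<nu>) m * real (down_chains (sum_list \<nu>) \<nu>) *
        mean_weight (real (sum_list \<nu>)) m"
      using Suc.IH[of \<nu> m] Suc.prems by simp
  qed (use Suc.prems oscillating_tableaux_empty in auto)
  ultimately have "(\<Sum>T\<in>oscillating_tableaux \<mu> (Suc l). real (wt_2_0 T)) * (real ?k + 2 * real n) =
      ?c * ((real ?k + 2 * real n) * mean_weight ?k n)"
    unfolding mean_weight_rec by (simp add: algebra_simps)
  moreover have "real ?k + 2 * real n \<noteq> 0"
    using Suc.prems by linarith
  ultimately show ?case by simp
qed

theorem corollary1p5: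
  fixes \<mu> :: "nat list" and k n :: nat
  assumes "is_partition \<mu>" and "k = sum_list \<mu>"
  shows "1 / real (card (oscillating_tableaux \<mu> (k + 2 * n))) *
           (\<Sum>T\<in>oscillating_tableaux \<mu> (k + 2 * n). real (wt_2_0 T)) =
         (real k + 2 * real n + 1) *
           ((10 * (real k)\<^sup>2 + 4 * (real n)\<^sup>2 + 10 * real k * real n + 5 * real k + 6 * real n) / 30)"
proof -
  \<comment> \<open>The count and the weight sum share these two factors; being nonzero, they cancel
    and leave \<open>mean_weight\<close>.\<close>
  have "osc_coeff k n \<noteq> 0" "down_chains k \<mu> \<noteq> 0"
    using osc_coeff_pos[of k n] down_chains_pos[of \<mu> k] assms by auto
  then show ?thesis
    using card_oscillating_tableaux[OF assms(1), of _ n] sum_wt_oscillating_tableaux[OF assms(1), of _ n]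
      assms(2) by (simp add: mean_weight_def)
qed

end
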